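(* Let $S$ be a set of sorts and $\Sigma$ an $S$-sorted signature. The ordered set $\mathbf{Form}_{\mathrm{Cgr}}(\Sigma)$ of all formations of congruences with respect to $\Sigma$, ordered pointwise by inclusion, is an algebraic lattice.
   Context: Fix a Grothendieck universe $\mathcal{U}$, a set of sorts $S\in\mathcal{U}$ and an $S$-sorted signature $\Sigma$, i.e. a family of sets $\Sigma_{w,s}\in\mathcal{U}$ indexed by $w\in S^{\star}$ (finite words on $S$) and $s\in S$. An $S$-sorted set is a family $A=(A_s)_{s\in S}$ of sets in $\mathcal{U}$ (components may be empty); $\mathcal{U}^S$ is the set of all of them. A $\Sigma$-algebra $\mathbf{A}$ is an $S$-sorted set $A$ with an operation $F_\sigma\colon A_w=\prod_{i<|w|}A_{w_i}\to A_s$ for each $\sigma\in\Sigma_{w,s}$; homomorphisms are $S$-sorted (componentwise) mappings commuting with all operations. Epimorphism means homomorphism surjective in each sort. A congruence on $\mathbf{A}$ is a family $\Phi=(\Phi_s)_{s\in S}$ of equivalence relations $\Phi_s$ on $A_s$ compatible with all operations; $\mathbf{Cgr}(\mathbf{A})$ is the lattice of all congruences under componentwise inclusion, $\mathbf{A}/\Phi$ the quotient algebra and $\mathrm{pr}^{\Phi}\colon\mathbf{A}\to\mathbf{A}/\Phi$ the projection. $\mathbf{T}_\Sigma(A)$ is the free $\Sigma$-algebra on the $S$-sorted set $A$. $\mathrm{Ker}(f)$ is the (componentwise) kernel congruence of $f$. A formation of congruences with respect to $\Sigma$ is a function $\mathfrak{F}$ on $\mathcal{U}^S$ such that: (1)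 for every $A\in\mathcal{U}^S$, $\mathfrak{F}(A)$ is a filter of $\mathbf{Cgr}(\mathbf{T}_\Sigma(A))$ (nonempty, closed under binary intersection, upward closed); (2) for all $A,B\in\mathcal{U}^S$, $\Theta\in\mathfrak{F}(B)$ and homomorphisms $f\colon\mathbf{T}_\Sigma(A)\to\mathbf{T}_\Sigma(B)$, if $\mathrm{pr}^{\Theta}\circ f$ is an epimorphism, then $\mathrm{Ker}(\mathrm{pr}^{\Theta}\circ f)\in\mathfrak{F}(A)$. The order is $\mathfrak{F}\le\mathfrak{G}$ iff $\mathfrak{F}(A)\subseteq\mathfrak{G}(A)$ for all $A\in\mathcal{U}^S$. An algebraic lattice is a complete lattice in which every element is a join of compact elements. *)

theory Defs
  imports "HOL-Algebra.Complete_Lattice" "HOL-Library.FuncSet"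
begin

section \<open>Universes, sorted sets and signatures\<close>

text \<open>
  A Grothendieck universe is represented by a type \<open>'u\<close> (the members of the universe) and the map
  \<open>elts\<close> sending a member to the set of its elements; these elements again have type \<open>'u\<close>, which is
  transitivity of the universe. The sets belonging to the universe are thus the sets in
  \<open>range elts\<close>. The conjuncts below are extensionality and closure under pairs, power sets
  and unions of families indexed by a member. The power set clause says that
  \<^emph>\<open>every\<close> subset of \<open>elts x\<close> is in the universe and that these subsets form a member \<open>p\<close>.
\<close>

definition grothendieck_universe :: "('u \<Rightarrow> 'u set) \<Rightarrow> bool" where
  "grothendieck_universe elts \<longleftrightarrow>
     inj elts \<and>
     (\<forall>x y. {x, y} \<in> range elts) \<and>
     (\<forall>x. \<exists>p. elts ` elts p = Pow (elts x)) \<and>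
     (\<forall>i x. (\<Union>j\<in>elts i. elts (x j)) \<in> range elts)"

text \<open>\<open>sorted_sets S U\<close> is the set of all families of sets from \<open>U\<close> indexed by \<open>S\<close>.\<close>

definition sorted_sets :: "'s set \<Rightarrow> 'v set set \<Rightarrow> ('s \<Rightarrow> 'v set) set" where
  "sorted_sets S U = (S \<rightarrow>\<^sub>E U)"

text \<open>
  A signature gives for each word \<open>w\<close> and sort \<open>s\<close> the set of operation symbols
  \<open>\<Sigma> w s\<close>. Only its values at \<open>w \<in> lists S\<close> and \<open>s \<in> S\<close> are ever used; the sets \<open>\<Sigma> w s\<close>
  need not be disjoint.
\<close>

type_synonym ('s, 'f) signature = "'s list \<Rightarrow> 's \<Rightarrow> 'f set"

definition signature_in :: "'f set set \<Rightarrow> 's set \<Rightarrow> ('s, 'f) signature \<Rightarrow> bool" where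
  "signature_in U S \<Sigma> \<longleftrightarrow> (\<forall>w\<in>lists S. \<forall>s\<in>S. \<Sigma> w s \<in> U)"


section \<open>Algebras, homomorphisms, congruences and quotients\<close>

text \<open>\<open>oper A w s \<sigma>\<close> is the operation of \<open>\<sigma> \<in> \<Sigma> w s\<close>. The product over a word \<open>w\<close> of the
  components of \<open>A\<close> is \<open>listset (map (carr A) w)\<close>.\<close>

record ('s, 'f, 'a) sorted_algebra =
  carr :: "'s \<Rightarrow> 'a set"
  oper :: "'s list \<Rightarrow> 's \<Rightarrow> 'f \<Rightarrow> 'a list \<Rightarrow> 'a"

definition sigma_algebra ::
    "'s set \<Rightarrow> ('s, 'f) signature \<Rightarrow> ('s, 'f, 'a) sorted_algebra \<Rightarrow> bool" where
  "sigma_algebra S \<Sigma> A \<longleftrightarrow>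
     (\<forall>w\<in>lists S. \<forall>s\<in>S. \<forall>\<sigma>\<in>\<Sigma> w s. oper A w s \<sigma> \<in> listset (map (carr A) w) \<rightarrow> carr A s)"

definition homomorphism ::
    "'s set \<Rightarrow> ('s, 'f) signature \<Rightarrow> ('s, 'f, 'a) sorted_algebra \<Rightarrow> ('s, 'f, 'b) sorted_algebra \<Rightarrow>
      ('s \<Rightarrow> 'a \<Rightarrow> 'b) \<Rightarrow> bool" where
  "homomorphism S \<Sigma> A B f \<longleftrightarrow>
     sigma_algebra S \<Sigma> A \<and> sigma_algebra S \<Sigma> B \<and>
     (\<forall>s\<in>S. f s \<in> carr A s \<rightarrow> carr B s) \<and>
     (\<forall>w\<in>lists S. \<forall>s\<in>S. \<forall>\<sigma>\<in>\<Sigma> w s. \<forall>xs\<in>listset (map (carr A) w).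
        f s (oper A w s \<sigma> xs) = oper B w s \<sigma> (map2 f w xs))"

definition epimorphism ::
    "'s set \<Rightarrow> ('s, 'f) signature \<Rightarrow> ('s, 'f, 'a) sorted_algebra \<Rightarrow> ('s, 'f, 'b) sorted_algebra \<Rightarrow>
      ('s \<Rightarrow> 'a \<Rightarrow> 'b) \<Rightarrow> bool" where
  "epimorphism S \<Sigma> A B f \<longleftrightarrow>
     homomorphism S \<Sigma> A B f \<and> (\<forall>s\<in>S. f s ` carr A s = carr B s)"

definition sorted_comp :: "('s \<Rightarrow> 'b \<Rightarrow> 'c) \<Rightarrow> ('s \<Rightarrow> 'a \<Rightarrow> 'b) \<Rightarrow> 's \<Rightarrow> 'a \<Rightarrow> 'c" where
  "sorted_comp g f = (\<lambda>s. g s \<circ> f s)"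

definition congruences ::
    "'s set \<Rightarrow> ('s, 'f) signature \<Rightarrow> ('s, 'f, 'a) sorted_algebra \<Rightarrow> ('s \<Rightarrow> 'a rel) set" where
  "congruences S \<Sigma> A =
     {\<Phi> \<in> extensional S.
       (\<forall>s\<in>S. equiv (carr A s) (\<Phi> s)) \<and>
       (\<forall>w\<in>lists S. \<forall>s\<in>S. \<forall>\<sigma>\<in>\<Sigma> w s.
          \<forall>xs\<in>listset (map (carr A) w). \<forall>ys\<in>listset (map (carr A) w).
            (\<forall>i<length w. (xs ! i, ys ! i) \<in> \<Phi> (w ! i)) \<longrightarrow>
            (oper A w s \<sigma> xs, oper A w s \<sigma> ys) \<in> \<Phi> s)}"

definition quotient_algebra ::
    "('s, 'f, 'a) sorted_algebra \<Rightarrow> ('s \<Rightarrow> 'a rel) \<Rightarrow> ('s, 'f, 'a set) sorted_algebra" where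
  "quotient_algebra A \<Phi> =
     \<lparr>carr = (\<lambda>s. carr A s // \<Phi> s),
      oper = (\<lambda>w s \<sigma> Xs. \<Union>xs\<in>listset Xs. \<Phi> s `` {oper A w s \<sigma> xs})\<rparr>"

definition projection :: "('s \<Rightarrow> 'a rel) \<Rightarrow> 's \<Rightarrow> 'a \<Rightarrow> 'a set" where
  "projection \<Phi> = (\<lambda>s x. \<Phi> s `` {x})"

definition kernel ::
    "'s set \<Rightarrow> ('s, 'f, 'a) sorted_algebra \<Rightarrow> ('s \<Rightarrow> 'a \<Rightarrow> 'b) \<Rightarrow> 's \<Rightarrow> 'a rel" where
  "kernel S A f =
     (\<lambda>s\<in>S. {(x, y). x \<in> carr A s \<and> y \<in> carr A s \<and> f s x = f s y})"


lemma listset_iff: "xs \<in> listset Xs \<longleftrightarrow> list_all2 (\<in>) xs Xs"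
  by (induction Xs arbitrary: xs) (auto simp: set_Cons_def list_all2_Cons2)

lemma listset_map_carr:
  "xs \<in> listset (map A w) \<longleftrightarrow> length xs = length w \<and> (\<forall>i<length w. xs ! i \<in> A (w ! i))"
  by (auto simp: listset_iff list_all2_conv_all_nth)

text \<open>On a tuple of classes the union defining the quotient operation is the class of the value at
  any representatives.\<close>

lemma oper_quotient_algebra:
  assumes "\<Phi> \<in> congruences S \<Sigma> A" "sigma_algebra S \<Sigma> A"
    "w \<in> lists S" "s \<in> S" "\<sigma> \<in> \<Sigma> w s" "xs \<in> listset (map (carr A) w)"
  shows "oper (quotient_algebra A \<Phi>) w s \<sigma> (map2 (projection \<Phi>) w xs) =
    projection \<Phi> s (oper A w s \<sigma> xs)"
proof -
  have len: "length xs = length w" and xs: "\<And>i. i < length w \<Longrightarrow> xs ! i \<in> carr A (w ! i)"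
    using assms(6) by (auto simp: listset_map_carr)
  have eqv: "equiv (carr A t) (\<Phi> t)" if "t \<in> S" for t
    using assms(1) that by (auto simp: congruences_def)
  have wS: "w ! i \<in> S" if "i < length w" for i
    using assms(3) that by (auto simp: in_lists_conv_set)
  have mem: "ys \<in> listset (map2 (projection \<Phi>) w xs) \<longleftrightarrow>
      length ys = length w \<and> (\<forall>i<length w. (xs ! i, ys ! i) \<in> \<Phi> (w ! i))" for ys
    using len by (auto simp: listset_iff list_all2_conv_all_nth projection_def)
  have eq: "\<Phi> s `` {oper A w s \<sigma> ys} = \<Phi> s `` {oper A w s \<sigma> xs}"
    if ys: "ys \<in> listset (map2 (projection \<Phi>) w xs)" for ys
  proof -
    have "ys \<in> listset (map (carr A) w)"
      using mem[THEN iffD1, OF ys] equiv_class_eq_iff[OF eqv[OF wS]]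
      by (auto simp: listset_map_carr)
    then have "(oper A w s \<sigma> xs, oper A w s \<sigma> ys) \<in> \<Phi> s"
      using mem[THEN iffD1, OF ys] assms by (simp add: congruences_def)
    then show ?thesis
      using equiv_class_eq[OF eqv[OF assms(4)]] by simp
  qed
  have "xs \<in> listset (map2 (projection \<Phi>) w xs)"
    using len xs equiv_class_eq_iff[OF eqv[OF wS]] by (intro mem[THEN iffD2]) auto
  then have "(\<Union>ys\<in>listset (map2 (projection \<Phi>) w xs). \<Phi> s `` {oper A w s \<sigma> ys}) =
      \<Phi> s `` {oper A w s \<sigma> xs}"
    using eq by blast
  then show ?thesis
    by (simp add: quotient_algebra_def projection_def)
qed

lemma epimorphism_projection:
  assumes "\<Phi> \<in> congruences S \<Sigma> A" "sigma_algebra S \<Sigma> A"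
  shows "epimorphism S \<Sigma> A (quotient_algebra A \<Phi>) (projection \<Phi>)"
proof -
  have surj: "projection \<Phi> s ` carr A s = carr (quotient_algebra A \<Phi>) s" for s
    by (auto simp: projection_def quotient_algebra_def quotient_def)
  have "sigma_algebra S \<Sigma> (quotient_algebra A \<Phi>)"
    unfolding sigma_algebra_def
  proof (intro ballI funcsetI)
    fix w s \<sigma> Xs
    assume h: "w \<in> lists S" "s \<in> S" "\<sigma> \<in> \<Sigma> w s"
      and Xs: "Xs \<in> listset (map (carr (quotient_algebra A \<Phi>)) w)"
    have "\<forall>i. \<exists>x. i < length w \<longrightarrow> x \<in> carr A (w ! i) \<and> Xs ! i = projection \<Phi> (w ! i) x"
      using Xs by (auto simp: listset_map_carr surj[symmetric])
    then obtain x where x: "\<And>i. i < length w \<Longrightarrow>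
        x i \<in> carr A (w ! i) \<and> Xs ! i = projection \<Phi> (w ! i) (x i)"
      by metis
    define xs where "xs = map x [0..<length w]"
    have xs: "xs \<in> listset (map (carr A) w)"
      using x by (simp add: xs_def listset_map_carr)
    have "Xs = map2 (projection \<Phi>) w xs"
      using x Xs by (intro nth_equalityI) (simp_all add: xs_def listset_map_carr)
    then have "oper (quotient_algebra A \<Phi>) w s \<sigma> Xs = projection \<Phi> s (oper A w s \<sigma> xs)"
      using oper_quotient_algebra[OF assms h xs] by simp
    moreover have "oper A w s \<sigma> xs \<in> carr A s"
      using assms(2) h xs unfolding sigma_algebra_def by blast
    ultimately show "oper (quotient_algebra A \<Phi>) w s \<sigma> Xs \<in> carr (quotient_algebra A \<Phi>) s"
      using surj by blast
  qed
  then show ?thesis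
    unfolding epimorphism_def homomorphism_def
    using assms surj oper_quotient_algebra[OF assms] by auto
qed


section \<open>The free algebra on a sorted set\<close>

text \<open>Variables and operation symbols carry their sort and rank, since neither the components of a
  sorted set nor those of a signature need be disjoint.\<close>

datatype ('s, 'f, 'v) sorted_term =
    Var 's 'v
  | Op "'s list" 's 'f "('s, 'f, 'v) sorted_term list"

inductive well_sorted ::
    "'s set \<Rightarrow> ('s, 'f) signature \<Rightarrow> ('s \<Rightarrow> 'v set) \<Rightarrow> ('s, 'f, 'v) sorted_term \<Rightarrow> 's \<Rightarrow> bool"
  for S :: "'s set" and \<Sigma> :: "('s, 'f) signature" and A :: "'s \<Rightarrow> 'v set" where
  Var: "s \<in> S \<Longrightarrow> x \<in> A s \<Longrightarrow> well_sorted S \<Sigma> A (Var s x) s"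
| Op: "w \<in> lists S \<Longrightarrow> s \<in> S \<Longrightarrow> \<sigma> \<in> \<Sigma> w s \<Longrightarrow> list_all2 (well_sorted S \<Sigma> A) ts w \<Longrightarrow>
        well_sorted S \<Sigma> A (Op w s \<sigma> ts) s"

definition free_algebra ::
    "'s set \<Rightarrow> ('s, 'f) signature \<Rightarrow> ('s \<Rightarrow> 'v set) \<Rightarrow>
      ('s, 'f, ('s, 'f, 'v) sorted_term) sorted_algebra" where
  "free_algebra S \<Sigma> A = \<lparr>carr = (\<lambda>s. {t. well_sorted S \<Sigma> A t s}), oper = Op\<rparr>"


lemma sigma_algebra_free_algebra: "sigma_algebra S \<Sigma> (free_algebra S \<Sigma> A)"
  by (auto simp: sigma_algebra_def free_algebra_def listset_map_carr list_all2_conv_all_nth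
      intro!: well_sorted.Op)

primrec term_eval ::
    "('s, 'f, 'b) sorted_algebra \<Rightarrow> ('s \<Rightarrow> 'v \<Rightarrow> 'b) \<Rightarrow> ('s, 'f, 'v) sorted_term \<Rightarrow> 'b" where
  "term_eval B g (Var s x) = g s x"
| "term_eval B g (Op w s \<sigma> ts) = oper B w s \<sigma> (map (term_eval B g) ts)"

text \<open>The universal property of the free algebra: existence and uniqueness of the homomorphic
  extension of a sorted mapping.\<close>

lemma free_algebra_extension:
  fixes S :: "'s set"
  assumes "sigma_algebra S \<Sigma> B" "\<And>s. s \<in> S \<Longrightarrow> g s \<in> A s \<rightarrow> carr B s"
  shows "homomorphism S \<Sigma> (free_algebra S \<Sigma> A) B (\<lambda>s. term_eval B g)"
proof -
  have in_carr: "term_eval B g t \<in> carr B s" if "well_sorted S \<Sigma> A t s" for t s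
    using that
  proof induction
    case (Var s x)
    then show ?case using assms(2) by auto
  next
    case (Op w s \<sigma> ts)
    then have "map (term_eval B g) ts \<in> listset (map (carr B) w)"
      by (auto simp: listset_map_carr list_all2_conv_all_nth)
    then show ?case
      using Op.hyps assms(1) unfolding sigma_algebra_def by auto
  qed
  have "map2 (\<lambda>s. term_eval B g) w xs = map (term_eval B g) xs"
    if "length xs = length w" for w :: "'s list" and xs
    using that by (intro nth_equalityI) auto
  then have "term_eval B g (Op w s \<sigma> xs) = oper B w s \<sigma> (map2 (\<lambda>s. term_eval B g) w xs)"
    if "xs \<in> listset (map (carr (free_algebra S \<Sigma> A)) w)" for w s \<sigma> xs
    using that by (simp only: listset_map_carr term_eval.simps)
  then show ?thesis
    unfolding homomorphism_def
    using assms(1) sigma_algebra_free_algebra[of S \<Sigma> A] in_carr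
    by (simp add: free_algebra_def Pi_iff)
qed

lemma free_algebra_extension_unique:
  assumes "homomorphism S \<Sigma> (free_algebra S \<Sigma> A) B h"
    "\<And>s x. s \<in> S \<Longrightarrow> x \<in> A s \<Longrightarrow> h s (Var s x) = g s x"
    "t \<in> carr (free_algebra S \<Sigma> A) s"
  shows "h s t = term_eval B g t"
proof -
  have "well_sorted S \<Sigma> A t s"
    using assms(3) by (simp add: free_algebra_def)
  then show ?thesis
  proof induction
    case (Var s x)
    then show ?case using assms(2) by simp
  next
    case (Op w s \<sigma> ts)
    then have "ts \<in> listset (map (carr (free_algebra S \<Sigma> A)) w)"
      by (auto simp: listset_map_carr list_all2_conv_all_nth free_algebra_def)
    then have "h s (Op w s \<sigma> ts) = oper B w s \<sigma> (map2 h w ts)"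
      using assms(1) Op.hyps unfolding homomorphism_def free_algebra_def by auto
    moreover have "map2 h w ts = map (term_eval B g) ts"
      using Op.IH by (intro nth_equalityI) (auto simp: list_all2_conv_all_nth)
    ultimately show ?case by simp
  qed
qed


section \<open>Formations of congruences\<close>

definition congruence_filter ::
    "'s set \<Rightarrow> ('s, 'f) signature \<Rightarrow> ('s, 'f, 'a) sorted_algebra \<Rightarrow> ('s \<Rightarrow> 'a rel) set \<Rightarrow> bool" where
  "congruence_filter S \<Sigma> A X \<longleftrightarrow>
     X \<subseteq> congruences S \<Sigma> A \<and>
     X \<noteq> {} \<and>
     (\<forall>\<Phi>\<in>X. \<forall>\<Psi>\<in>X. (\<lambda>s\<in>S. \<Phi> s \<inter> \<Psi> s) \<in> X) \<and>
     (\<forall>\<Phi>\<in>X. \<forall>\<Psi>\<in>congruences S \<Sigma> A. (\<forall>s\<in>S. \<Phi> s \<subseteq> \<Psi> s) \<longrightarrow> \<Psi> \<in> X)"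

type_synonym ('s, 'f, 'v) congruence_assignment =
  "('s \<Rightarrow> 'v set) \<Rightarrow> ('s \<Rightarrow> ('s, 'f, 'v) sorted_term rel) set"

definition formations ::
    "'v set set \<Rightarrow> 's set \<Rightarrow> ('s, 'f) signature \<Rightarrow> ('s, 'f, 'v) congruence_assignment set" where
  "formations U S \<Sigma> =
     {F \<in> extensional (sorted_sets S U).
       (\<forall>A\<in>sorted_sets S U. congruence_filter S \<Sigma> (free_algebra S \<Sigma> A) (F A)) \<and>
       (\<forall>A\<in>sorted_sets S U. \<forall>B\<in>sorted_sets S U. \<forall>\<Theta>\<in>F B. \<forall>f.
          homomorphism S \<Sigma> (free_algebra S \<Sigma> A) (free_algebra S \<Sigma> B) f \<longrightarrow>
          epimorphism S \<Sigma> (free_algebra S \<Sigma> A) (quotient_algebra (free_algebra S \<Sigma> B) \<Theta>)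
            (sorted_comp (projection \<Theta>) f) \<longrightarrow>
          kernel S (free_algebra S \<Sigma> A) (sorted_comp (projection \<Theta>) f) \<in> F A)}"

definition Form_Cgr ::
    "'v set set \<Rightarrow> 's set \<Rightarrow> ('s, 'f) signature \<Rightarrow> ('s, 'f, 'v) congruence_assignment gorder" where
  "Form_Cgr U S \<Sigma> =
     \<lparr>carrier = formations U S \<Sigma>, eq = (=),
      le = (\<lambda>F G. \<forall>A\<in>sorted_sets S U. F A \<subseteq> G A)\<rparr>"


section \<open>Algebraic lattices\<close>

definition compact_element :: "('a, 'm) gorder_scheme \<Rightarrow> 'a \<Rightarrow> bool" where
  "compact_element L k \<longleftrightarrow>
     k \<in> carrier L \<and>
     (\<forall>X\<subseteq>carrier L. k \<sqsubseteq>\<^bsub>L\<^esub> \<Squnion>\<^bsub>L\<^esub>X \<longrightarrow> (\<exists>Y\<subseteq>X. finite Y \<and> k \<sqsubseteq>\<^bsub>L\<^esub> \<Squnion>\<^bsub>L\<^esub>Y))"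

locale algebraic_lattice = complete_lattice L for L (structure) +
  assumes join_of_compact:
    "x \<in> carrier L \<Longrightarrow> \<exists>K\<subseteq>{k. compact_element L k}. x = \<Squnion>K"

end

(* Formations are closed under pointwise intersections and pointwise directed unions, since each
   defining condition has finitely many premises of the form "a congruence belongs to F(A)". They
   therefore form an algebraic closure system on the disjoint union of the sets Cgr(T(A)): the
   formations generated by a single congruence are compact and every formation is the join of those
   generated by its members. *)

theory Submission
  imports Defs
begin

section \<open>Families closed under intersections and directed unions\<close>

text \<open>A family \<open>F\<close> stands for the set of pairs (i, b) with b in
  \<open>F i\<close>, so no disjoint union has to be formed. Extensionality outside \<open>I\<close>
  makes pointwise inclusion antisymmetric; \<open>T\<close> supplies the empty meet, which
  \<open>Int\<close> leaves out.\<close>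

lemma algebraic_lattice_closure_system:
  fixes C :: "('i \<Rightarrow> 'b set) set"
  assumes ext: "C \<subseteq> extensional I"
    and T: "T \<in> C" "\<And>F i. F \<in> C \<Longrightarrow> i \<in> I \<Longrightarrow> F i \<subseteq> T i"
    and Int: "\<And>X. X \<subseteq> C \<Longrightarrow> X \<noteq> {} \<Longrightarrow> (\<lambda>i\<in>I. \<Inter>F\<in>X. F i) \<in> C"
    and dir: "\<And>X. X \<subseteq> C \<Longrightarrow> X \<noteq> {} \<Longrightarrow>
      (\<And>F G. F \<in> X \<Longrightarrow> G \<in> X \<Longrightarrow> \<exists>H\<in>X. \<forall>i\<in>I. F i \<union> G i \<subseteq> H i) \<Longrightarrow> (\<lambda>i\<in>I. \<Union>F\<in>X. F i) \<in> C"
  shows "algebraic_lattice \<lparr>carrier = C, eq = (=), le = (\<lambda>F G. \<forall>i\<in>I. F i \<subseteq> G i)\<rparr>"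
    (is "algebraic_lattice ?L")
proof -
  interpret partial_order ?L
  proof
    fix F G
    assume "F \<sqsubseteq>\<^bsub>?L\<^esub> G" "G \<sqsubseteq>\<^bsub>?L\<^esub> F" "F \<in> carrier ?L" "G \<in> carrier ?L"
    then show "F .=\<^bsub>?L\<^esub> G"
      using ext by (auto intro!: extensionalityI[of F I G])
  qed auto
  interpret complete_lattice ?L
  proof (rule complete_lattice_criterion1)
    show "\<exists>g. greatest ?L g (carrier ?L)"
      using T by (auto simp: greatest_def intro!: exI[of _ T])
  next
    fix X
    assume "X \<subseteq> carrier ?L" "X \<noteq> {}"
    then show "\<exists>i. is_glb ?L i X"
      using Int[of X]
      by (intro exI[of _ "\<lambda>i\<in>I. \<Inter>F\<in>X. F i"]) (auto simp: greatest_def Lower_def)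
  qed
  \<comment> \<open>The join is never computed: from here on it is known only as the least upper
    bound within \<open>C\<close>.\<close>
  have sup_in: "\<Squnion>\<^bsub>?L\<^esub>X \<in> C" if "X \<subseteq> C" for X
    using sup_closed[of X] that by simp
  have sup_ub: "F i \<subseteq> (\<Squnion>\<^bsub>?L\<^esub>X) i" if "X \<subseteq> C" "F \<in> X" "i \<in> I" for X F i
    using sup_upper[of X F] that by simp
  have sup_le: "(\<Squnion>\<^bsub>?L\<^esub>X) i \<subseteq> G i"
    if "X \<subseteq> C" "G \<in> C" "\<And>F i. F \<in> X \<Longrightarrow> i \<in> I \<Longrightarrow> F i \<subseteq> G i" "i \<in> I" for X G i
    using sup_least[of X G] that by simp
  have sup_finite: "\<exists>Y\<subseteq>X. finite Y \<and> b \<in> (\<Squnion>\<^bsub>?L\<^esub>Y) i"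
    if X: "X \<subseteq> C" and i: "i \<in> I" and b: "b \<in> (\<Squnion>\<^bsub>?L\<^esub>X) i" for X i b
  proof -
    \<comment> \<open>The joins of finite subsets are directed, since those of \<open>Y\<close> and
      \<open>Y'\<close> lie below that of their union. Hence \<open>D\<close> is in
      \<open>C\<close>, and the singletons make it an upper bound of \<open>X\<close>. The empty
      subset keeps \<open>Z\<close> nonempty even when \<open>X\<close> is empty.\<close>
    define Z where "Z = {\<Squnion>\<^bsub>?L\<^esub>Y | Y. Y \<subseteq> X \<and> finite Y}"
    define D where "D = (\<lambda>i\<in>I. \<Union>F\<in>Z. F i)"
    have "D \<in> C"
      unfolding D_def
    proof (rule dir)
      show "Z \<subseteq> C" "Z \<noteq> {}"
        using X sup_in unfolding Z_def by blast+
    next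
      fix F G
      assume "F \<in> Z" "G \<in> Z"
      then obtain Y Y' where Y: "F = \<Squnion>\<^bsub>?L\<^esub>Y" "Y \<subseteq> X" "finite Y"
        and Y': "G = \<Squnion>\<^bsub>?L\<^esub>Y'" "Y' \<subseteq> X" "finite Y'"
        unfolding Z_def by blast
      have "\<Squnion>\<^bsub>?L\<^esub>(Y \<union> Y') \<in> Z"
        using Y Y' unfolding Z_def by blast
      moreover have "F i \<subseteq> (\<Squnion>\<^bsub>?L\<^esub>(Y \<union> Y')) i" "G i \<subseteq> (\<Squnion>\<^bsub>?L\<^esub>(Y \<union> Y')) i" if "i \<in> I" for i
        unfolding Y(1) Y'(1) using Y(2) Y'(2) X that by (intro sup_le sup_in sup_ub; blast)+
      ultimately show "\<exists>H\<in>Z. \<forall>i\<in>I. F i \<union> G i \<subseteq> H i"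
        by blast
    qed
    moreover have "F j \<subseteq> D j" if "F \<in> X" "j \<in> I" for F j
    proof -
      have "\<Squnion>\<^bsub>?L\<^esub>{F} \<in> Z"
        using that unfolding Z_def by blast
      moreover have "F j \<subseteq> (\<Squnion>\<^bsub>?L\<^esub>{F}) j"
        using that X by (intro sup_ub) auto
      ultimately show ?thesis
        using that unfolding D_def by auto
    qed
    ultimately have "(\<Squnion>\<^bsub>?L\<^esub>X) i \<subseteq> D i"
      using X i by (intro sup_le)
    then show ?thesis
      using b i unfolding D_def Z_def by auto
  qed
  \<comment> \<open>The least member of \<open>C\<close> having \<open>b\<close> in component
    \<open>i\<close>, provided some member does; otherwise the intersection is empty-indexed and
    yields \<open>UNIV\<close>, hence the witness \<open>F\<close> in \<open>gen_in\<close>.\<close>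
  define gen where "gen i b = (\<lambda>j\<in>I. \<Inter>F\<in>{F \<in> C. b \<in> F i}. F j)" for i b
  have gen_le: "gen i b j \<subseteq> F j" if "F \<in> C" "b \<in> F i" "j \<in> I" for i b j F
    using that unfolding gen_def by auto
  have in_gen: "b \<in> gen i b i" if "i \<in> I" for i b
    using that unfolding gen_def by auto
  have gen_in: "gen i b \<in> C" if "F \<in> C" "b \<in> F i" for i b F
    unfolding gen_def using that by (intro Int) auto
  \<comment> \<open>By leastness, \<open>gen i b\<close> lies below a member \<open>G\<close> of
    \<open>C\<close> iff b is in \<open>G i\<close>, so compactness reduces to
    \<open>sup_finite\<close>.\<close>
  have compact: "compact_element ?L (gen i b)" if F: "F \<in> C" "b \<in> F i" and i: "i \<in> I" for i b F
    unfolding compact_element_def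
  proof (intro conjI allI impI)
    show "gen i b \<in> carrier ?L"
      using gen_in[of F b i] F by simp
  next
    fix X
    assume X: "X \<subseteq> carrier ?L" and le: "gen i b \<sqsubseteq>\<^bsub>?L\<^esub> \<Squnion>\<^bsub>?L\<^esub>X"
    have "b \<in> (\<Squnion>\<^bsub>?L\<^esub>X) i"
      using le i in_gen by auto
    then obtain Y where "Y \<subseteq> X" "finite Y" "b \<in> (\<Squnion>\<^bsub>?L\<^esub>Y) i"
      using sup_finite[of X i b] X i by auto
    moreover from this have "gen i b \<sqsubseteq>\<^bsub>?L\<^esub> \<Squnion>\<^bsub>?L\<^esub>Y"
      using X gen_le[OF sup_in] by auto
    ultimately show "\<exists>Y\<subseteq>X. finite Y \<and> gen i b \<sqsubseteq>\<^bsub>?L\<^esub> \<Squnion>\<^bsub>?L\<^esub>Y"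
      by blast
  qed
  show ?thesis
  proof
    fix F
    assume "F \<in> carrier ?L"
    then have F: "F \<in> C"
      by simp
    define K where "K = {gen i b | i b. i \<in> I \<and> b \<in> F i}"
    have K: "K \<subseteq> C"
      using gen_in F unfolding K_def by blast
    have "F i = (\<Squnion>\<^bsub>?L\<^esub>K) i" if i: "i \<in> I" for i
    proof
      show "F i \<subseteq> (\<Squnion>\<^bsub>?L\<^esub>K) i"
      proof
        fix b
        assume "b \<in> F i"
        then have "gen i b \<in> K"
          using i unfolding K_def by blast
        then show "b \<in> (\<Squnion>\<^bsub>?L\<^esub>K) i"
          using sup_ub[OF K] in_gen i by blast
      qed
      show "(\<Squnion>\<^bsub>?L\<^esub>K) i \<subseteq> F i"
        using K F i gen_le[OF F] unfolding K_def by (intro sup_le) blast+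
    qed
    then have "F = \<Squnion>\<^bsub>?L\<^esub>K"
      using F ext sup_in[OF K] by (auto intro: extensionalityI[of F I])
    moreover have "K \<subseteq> {k. compact_element ?L k}"
      using compact F unfolding K_def by blast
    ultimately show "\<exists>K\<subseteq>{k. compact_element ?L k}. F = \<Squnion>\<^bsub>?L\<^esub>K"
      by blast
  qed
qed

section \<open>Kernels and congruences\<close>

text \<open>Arguments with the same images under \<open>f\<close> give results with the same image,
  as \<open>f\<close> commutes with the operations. This is what condition (2) demands of the
  greatest formation.\<close>

lemma kernel_in_congruences:
  assumes "homomorphism S \<Sigma> A B f"
  shows "kernel S A f \<in> congruences S \<Sigma> A"
  unfolding congruences_def
proof (intro CollectI conjI ballI impI)
  show "kernel S A f \<in> extensional S"
    by (simp add: kernel_def)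
  show "equiv (carr A s) (kernel S A f s)" if "s \<in> S" for s
    using that by (auto simp: kernel_def equiv_def refl_on_def sym_def trans_def)
next
  fix w s \<sigma> xs ys
  assume h: "w \<in> lists S" "s \<in> S" "\<sigma> \<in> \<Sigma> w s"
    and xs: "xs \<in> listset (map (carr A) w)" and ys: "ys \<in> listset (map (carr A) w)"
    and ker: "\<forall>i<length w. (xs ! i, ys ! i) \<in> kernel S A f (w ! i)"
  \<comment> \<open>The letters of \<open>w\<close> lie in \<open>S\<close>, where
    \<open>kernel\<close> has its intended value and not \<open>undefined\<close>.\<close>
  have "map2 f w xs = map2 f w ys"
    using xs ys ker h(1)
    by (intro nth_equalityI) (auto simp: listset_map_carr kernel_def in_lists_conv_set)
  then have "f s (oper A w s \<sigma> xs) = f s (oper A w s \<sigma> ys)"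
    using assms h xs ys unfolding homomorphism_def by simp
  moreover have "oper A w s \<sigma> zs \<in> carr A s" if "zs \<in> listset (map (carr A) w)" for zs
    using assms h that unfolding homomorphism_def sigma_algebra_def by blast
  ultimately show "(oper A w s \<sigma> xs, oper A w s \<sigma> ys) \<in> kernel S A f s"
    using h xs ys by (simp add: kernel_def)
qed

lemma full_congruence:
  assumes "sigma_algebra S \<Sigma> A"
  shows "(\<lambda>s\<in>S. carr A s \<times> carr A s) \<in> congruences S \<Sigma> A"
  using assms by (auto simp: congruences_def sigma_algebra_def equiv_def refl_on_def sym_def trans_def Pi_iff)

lemma congruences_Int:
  assumes "\<Phi> \<in> congruences S \<Sigma> A" "\<Psi> \<in> congruences S \<Sigma> A"
  shows "(\<lambda>s\<in>S. \<Phi> s \<inter> \<Psi> s) \<in> congruences S \<Sigma> A"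
proof -
  have "equiv (carr A s) (\<Phi> s \<inter> \<Psi> s)" if "s \<in> S" for s
  proof -
    have "equiv (carr A s) (\<Phi> s)" "equiv (carr A s) (\<Psi> s)"
      using assms that by (auto simp: congruences_def)
    then show ?thesis
      by (auto simp: equiv_def refl_on_def intro: sym_Int trans_Int)
  qed
  then show ?thesis
    using assms by (auto simp: congruences_def in_lists_conv_set)
qed

section \<open>Filters of congruences\<close>

lemma congruence_filter_congruences:
  assumes "sigma_algebra S \<Sigma> A"
  shows "congruence_filter S \<Sigma> A (congruences S \<Sigma> A)"
  using full_congruence[OF assms] congruences_Int unfolding congruence_filter_def by blast

text \<open>Nonemptiness and upward closure put the largest congruence into every filter; it serves
  as a common element of any family of filters.\<close>

lemma full_congruence_in_filter:
  assumes "congruence_filter S \<Sigma> A X" "sigma_algebra S \<Sigma> A"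
  shows "(\<lambda>s\<in>S. carr A s \<times> carr A s) \<in> X"
proof -
  obtain \<Phi> where \<Phi>: "\<Phi> \<in> X"
    using assms(1) unfolding congruence_filter_def by blast
  then have "\<Phi> \<in> congruences S \<Sigma> A"
    using assms(1) unfolding congruence_filter_def by blast
  then have "\<forall>s\<in>S. \<Phi> s \<subseteq> (\<lambda>s\<in>S. carr A s \<times> carr A s) s"
    by (auto simp: congruences_def equiv_def)
  then show ?thesis
    using assms(1) \<Phi> full_congruence[OF assms(2)] unfolding congruence_filter_def by blast
qed

text \<open>Only nonemptiness of the intersection needs an argument, and the largest congruence
  provides it; the other conditions are inherited memberwise.\<close>

lemma congruence_filter_Inter:
  assumes "sigma_algebra S \<Sigma> A" "\<X> \<noteq> {}" "\<And>X. X \<in> \<X> \<Longrightarrow> congruence_filter S \<Sigma> A X"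
  shows "congruence_filter S \<Sigma> A (\<Inter>\<X>)"
proof -
  have "\<Inter>\<X> \<noteq> {}"
    using full_congruence_in_filter[OF assms(3) assms(1)] by blast
  then show ?thesis
    using assms(2,3) unfolding congruence_filter_def by (intro conjI) blast+
qed

text \<open>Closure under binary intersection is the only condition with two membership premises.
  Directedness places both congruences in one filter of the family.\<close>

lemma congruence_filter_directed_Union:
  assumes "\<X> \<noteq> {}" "\<And>X. X \<in> \<X> \<Longrightarrow> congruence_filter S \<Sigma> A X"
    and dir: "\<And>X Y. X \<in> \<X> \<Longrightarrow> Y \<in> \<X> \<Longrightarrow> \<exists>Z\<in>\<X>. X \<union> Y \<subseteq> Z"
  shows "congruence_filter S \<Sigma> A (\<Union>\<X>)"
proof -
  have "(\<lambda>s\<in>S. \<Phi> s \<inter> \<Psi> s) \<in> \<Union>\<X>" if "\<Phi> \<in> \<Union>\<X>" "\<Psi> \<in> \<Union>\<X>" for \<Phi> \<Psi>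
  proof -
    obtain Z where "Z \<in> \<X>" "\<Phi> \<in> Z" "\<Psi> \<in> Z"
      using \<open>\<Phi> \<in> \<Union>\<X>\<close> \<open>\<Psi> \<in> \<Union>\<X>\<close> dir by blast
    then show ?thesis
      using assms(2) unfolding congruence_filter_def by blast
  qed
  then show ?thesis
    using assms(1,2) unfolding congruence_filter_def by (intro conjI) blast+
qed

section \<open>Intersections and directed unions of formations\<close>

lemma congruence_filter_formation:
  "F \<in> formations U S \<Sigma> \<Longrightarrow> A \<in> sorted_sets S U \<Longrightarrow>
    congruence_filter S \<Sigma> (free_algebra S \<Sigma> A) (F A)"
  by (simp add: formations_def)

lemma kernel_in_formation:
  assumes "F \<in> formations U S \<Sigma>" "A \<in> sorted_sets S U" "B \<in> sorted_sets S U" "\<Theta> \<in> F B"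
    "homomorphism S \<Sigma> (free_algebra S \<Sigma> A) (free_algebra S \<Sigma> B) f"
    "epimorphism S \<Sigma> (free_algebra S \<Sigma> A) (quotient_algebra (free_algebra S \<Sigma> B) \<Theta>)
      (sorted_comp (projection \<Theta>) f)"
  shows "kernel S (free_algebra S \<Sigma> A) (sorted_comp (projection \<Theta>) f) \<in> F A"
  using assms unfolding formations_def by blast

lemma top_formation:
  "(\<lambda>A\<in>sorted_sets S U. congruences S \<Sigma> (free_algebra S \<Sigma> A)) \<in> formations U S \<Sigma>"
  using congruence_filter_congruences[OF sigma_algebra_free_algebra]
  by (auto simp: formations_def epimorphism_def intro: kernel_in_congruences)

lemma formation_Inter:
  assumes "X \<subseteq> formations U S \<Sigma>" "X \<noteq> {}"
  shows "(\<lambda>A\<in>sorted_sets S U. \<Inter>F\<in>X. F A) \<in> formations U S \<Sigma>"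
  unfolding formations_def
proof (intro CollectI conjI ballI allI impI)
  fix A
  assume "A \<in> sorted_sets S U"
  then show "congruence_filter S \<Sigma> (free_algebra S \<Sigma> A) ((\<lambda>A\<in>sorted_sets S U. \<Inter>F\<in>X. F A) A)"
    using assms congruence_filter_formation[of _ U S \<Sigma> A]
    by (auto intro!: congruence_filter_Inter sigma_algebra_free_algebra)
next
  fix A B \<Theta> f
  assume A: "A \<in> sorted_sets S U" and B: "B \<in> sorted_sets S U"
    and \<Theta>: "\<Theta> \<in> (\<lambda>A\<in>sorted_sets S U. \<Inter>F\<in>X. F A) B"
    and f: "homomorphism S \<Sigma> (free_algebra S \<Sigma> A) (free_algebra S \<Sigma> B) f"
      "epimorphism S \<Sigma> (free_algebra S \<Sigma> A) (quotient_algebra (free_algebra S \<Sigma> B) \<Theta>)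
        (sorted_comp (projection \<Theta>) f)"
  \<comment> \<open>The conditions on \<open>f\<close> mention \<Theta> but no formation, so
    condition (2) can be applied in each \<open>F\<close> separately.\<close>
  have "kernel S (free_algebra S \<Sigma> A) (sorted_comp (projection \<Theta>) f) \<in> F A"
    if "F \<in> X" "\<Theta> \<in> F B" for F
    using that assms(1) A B f by (intro kernel_in_formation[where B = B and F = F]) auto
  then show "kernel S (free_algebra S \<Sigma> A) (sorted_comp (projection \<Theta>) f) \<in>
      (\<lambda>A\<in>sorted_sets S U. \<Inter>F\<in>X. F A) A"
    using \<Theta> A B by auto
qed simp

text \<open>Directedness enters only through the filter condition. Condition (2) has a single
  membership premise, so the \<open>F\<close> containing \<Theta> at \<open>B\<close> already
  contains the kernel at \<open>A\<close>.\<close>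

lemma formation_directed_Union:
  assumes "X \<subseteq> formations U S \<Sigma>" "X \<noteq> {}"
    and dir: "\<And>F G. F \<in> X \<Longrightarrow> G \<in> X \<Longrightarrow> \<exists>H\<in>X. \<forall>A\<in>sorted_sets S U. F A \<union> G A \<subseteq> H A"
  shows "(\<lambda>A\<in>sorted_sets S U. \<Union>F\<in>X. F A) \<in> formations U S \<Sigma>"
  unfolding formations_def
proof (intro CollectI conjI ballI allI impI)
  fix A
  assume A: "A \<in> sorted_sets S U"
  have "congruence_filter S \<Sigma> (free_algebra S \<Sigma> A) (\<Union>((\<lambda>F. F A) ` X))"
  proof (rule congruence_filter_directed_Union)
    show "congruence_filter S \<Sigma> (free_algebra S \<Sigma> A) Y" if "Y \<in> (\<lambda>F. F A) ` X" for Y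
      using that assms(1) congruence_filter_formation[OF _ A] by blast
    show "\<exists>W\<in>(\<lambda>F. F A) ` X. Y \<union> Z \<subseteq> W"
      if YZ: "Y \<in> (\<lambda>F. F A) ` X" "Z \<in> (\<lambda>F. F A) ` X" for Y Z
    proof -
      obtain F G where FG: "F \<in> X" "G \<in> X" "Y = F A" "Z = G A"
        using YZ by blast
      then obtain H where "H \<in> X" "F A \<union> G A \<subseteq> H A"
        using dir[of F G] A by blast
      then show ?thesis
        using FG by blast
    qed
  qed (simp add: assms(2))
  then show "congruence_filter S \<Sigma> (free_algebra S \<Sigma> A) ((\<lambda>A\<in>sorted_sets S U. \<Union>F\<in>X. F A) A)"
    using A by simp
next
  fix A B \<Theta> f
  assume A: "A \<in> sorted_sets S U" and B: "B \<in> sorted_sets S U"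
    and \<Theta>: "\<Theta> \<in> (\<lambda>A\<in>sorted_sets S U. \<Union>F\<in>X. F A) B"
    and f: "homomorphism S \<Sigma> (free_algebra S \<Sigma> A) (free_algebra S \<Sigma> B) f"
      "epimorphism S \<Sigma> (free_algebra S \<Sigma> A) (quotient_algebra (free_algebra S \<Sigma> B) \<Theta>)
        (sorted_comp (projection \<Theta>) f)"
  have "kernel S (free_algebra S \<Sigma> A) (sorted_comp (projection \<Theta>) f) \<in> F A"
    if "F \<in> X" "\<Theta> \<in> F B" for F
    using that assms(1) A B f by (intro kernel_in_formation[where B = B and F = F]) auto
  then show "kernel S (free_algebra S \<Sigma> A) (sorted_comp (projection \<Theta>) f) \<in>
      (\<lambda>A\<in>sorted_sets S U. \<Union>F\<in>X. F A) A"
    using \<Theta> A B by auto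
qed simp

theorem corollary3p16:
  fixes elts :: "'u \<Rightarrow> 'u set" and S :: "'u set" and \<Sigma> :: "('u, 'u) signature"
  assumes "grothendieck_universe elts"
    and "S \<in> range elts"
    and "signature_in (range elts) S \<Sigma>"
  shows "algebraic_lattice (Form_Cgr (range elts) S \<Sigma>)"
  unfolding Form_Cgr_def
proof (rule algebraic_lattice_closure_system)
  show "formations (range elts) S \<Sigma> \<subseteq> extensional (sorted_sets S (range elts))"
    by (auto simp: formations_def)
  \<comment> \<open>The role of \<open>T\<close> is taken by the assignment of all congruences,
    which dominates every formation because filters consist of congruences.\<close>
  show "F A \<subseteq> (\<lambda>A\<in>sorted_sets S (range elts). congruences S \<Sigma> (free_algebra S \<Sigma> A)) A"
    if "F \<in> formations (range elts) S \<Sigma>" "A \<in> sorted_sets S (range elts)" for F A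
    using congruence_filter_formation[OF that] that(2) by (simp add: congruence_filter_def)
qed (fact top_formation formation_Inter formation_directed_Union)+

end
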